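(* Suppose $\phi(x)=\max_{y_1\in Y_1}\{d_{l1}^\top y_1+\varphi(x,y_1)\}$ is quasi-supermodular, i.e. for every $y_1\in Y_1$ the function $x\mapsto\varphi(x,y_1)$ is supermodular on $\{0,1\}^{n_x}$. Let $z\in\{0,1\}^{n_x}$, let $\hat y_1\in\arg\max_{y_1\in Y_1}\{d_{l1}^\top y_1+\varphi(z,y_1)\}$, let $\mathcal S_z:=\{i\in[n_x]:z_i=1\}$, and for $\mathcal S\subseteq[n_x]$, $i\in[n_x]\setminus\mathcal S$, $y_1\in Y_1$ let $\delta(\mathcal S,\{i\},y_1):=\varphi(\mathcal S\cup\{i\},y_1)-\varphi(\mathcal S,y_1)$. Then the inequality $$d_\ell^\top y\ge d_{l1}^\top\hat y_1+\varphi(\mathcal S_z,\hat y_1)-\sum_{i\in\mathcal S_z}\delta([n_x]\setminus\{i\},\{i\},\hat y_1)(1-x_i)+\sum_{i\in[n_x]\setminus\mathcal S_z}\delta(\mathcal S_z,\{i\},\hat y_1)x_i$$ is valid and tight for $d_\ell^\top y\ge\phi(x)$, i.e. its right-hand side is at most $\phi(x)$ for all $x\in\{0,1\}^{n_x}$, with equality for some $x\in\{0,1\}^{n_x}$.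
   Context: The lower-level variable splits as $y=(y_1,y_2)\in Y=Y_1\times Y_2$, $Y_1\subseteq\mathbb{R}^{n_{y_1}}$ the domain of the integer lower-level variables, $Y_2\subseteq\mathbb{R}^{n_{y_2}}$; correspondingly $d_\ell=(d_{l1},d_{l2})$ and $B_\ell=[B_{l1},B_{l2}]$, and $A_\ell,h_\ell$ are real data of compatible dimensions. For $x\in\{0,1\}^{n_x}$, $y_1\in Y_1$, $$\varphi(x,y_1)=\max\{d_{l2}^\top y_2 : y_2\in Y_2,\ B_{l2}y_2\le h_\ell-A_\ell x-B_{l1}y_1\},$$ real-valued, and the maximum defining $\phi(x)\in\mathbb{R}$ is attained. For a set $\mathcal S\subseteq[n_x]=\{1,\dots,n_x\}$, $\varphi(\mathcal S,y_1):=\varphi(s,y_1)$ where $s\in\{0,1\}^{n_x}$ is the indicator vector of $\mathcal S$. A function $f:\{0,1\}^{n}\to\mathbb{R}$ is supermodular if $f(x')+f(x'')\le f(x'\vee x'')+f(x'\wedge x'')$ for all $x',x''$ (entrywise max/min). *)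

theory Defs
  imports "HOL-Analysis.Analysis"
begin

definition binary_vectors :: "(real ^ 'n) set" where
  "binary_vectors = {x. \<forall>i. x $ i \<in> {0, 1}}"

definition indicator_vec :: "'n set \<Rightarrow> real ^ 'n" where
  "indicator_vec S = (\<chi> i. indicator S i)"

(* On real ^ 'n, sup and inf are the entrywise maximum and minimum. *)
definition supermodular :: "(real ^ 'n \<Rightarrow> real) \<Rightarrow> bool" where
  "supermodular f \<longleftrightarrow>
     (\<forall>x' \<in> binary_vectors. \<forall>x'' \<in> binary_vectors. f x' + f x'' \<le> f (sup x' x'') + f (inf x' x''))"

(* Possibly infinite sets of reals are maximised, so Max does not apply. The value of
   maximum is meaningful only for sets satisfying has_maximum. *)
definition has_maximum :: "real set \<Rightarrow> bool" where
  "has_maximum V \<longleftrightarrow> (\<exists>m \<in> V. \<forall>v \<in> V. v \<le> m)"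

definition maximum :: "real set \<Rightarrow> real" where
  "maximum V = (GREATEST v. v \<in> V)"

(* The order on real ^ 'm is entrywise. *)
definition restricted_values ::
  "real ^ 'n2 \<Rightarrow> (real ^ 'n2) set \<Rightarrow> real ^ 'nx ^ 'm \<Rightarrow> real ^ 'n1 ^ 'm \<Rightarrow> real ^ 'n2 ^ 'm
    \<Rightarrow> real ^ 'm \<Rightarrow> real ^ 'nx \<Rightarrow> real ^ 'n1 \<Rightarrow> real set" where
  "restricted_values d2 Y2 A B1 B2 h x y1 =
     {d2 \<bullet> y2 | y2. y2 \<in> Y2 \<and> B2 *v y2 \<le> h - A *v x - B1 *v y1}"

definition restricted_value ::
  "real ^ 'n2 \<Rightarrow> (real ^ 'n2) set \<Rightarrow> real ^ 'nx ^ 'm \<Rightarrow> real ^ 'n1 ^ 'm \<Rightarrow> real ^ 'n2 ^ 'm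
    \<Rightarrow> real ^ 'm \<Rightarrow> real ^ 'nx \<Rightarrow> real ^ 'n1 \<Rightarrow> real" where
  "restricted_value d2 Y2 A B1 B2 h x y1 = maximum (restricted_values d2 Y2 A B1 B2 h x y1)"

(* In the following, F x y1 is the optimal value over y2 alone,
   with x and y1 fixed. *)
definition lower_values ::
  "real ^ 'n1 \<Rightarrow> (real ^ 'n1) set \<Rightarrow> (real ^ 'nx \<Rightarrow> real ^ 'n1 \<Rightarrow> real) \<Rightarrow> real ^ 'nx \<Rightarrow> real set" where
  "lower_values d1 Y1 F x = {d1 \<bullet> y1 + F x y1 | y1. y1 \<in> Y1}"

definition lower_value ::
  "real ^ 'n1 \<Rightarrow> (real ^ 'n1) set \<Rightarrow> (real ^ 'nx \<Rightarrow> real ^ 'n1 \<Rightarrow> real) \<Rightarrow> real ^ 'nx \<Rightarrow> real" where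
  "lower_value d1 Y1 F x = maximum (lower_values d1 Y1 F x)"

(* A property of the representation (Y1, F) of the lower-level value function, not of
   that function alone. *)
definition quasi_supermodular ::
  "(real ^ 'n1) set \<Rightarrow> (real ^ 'nx \<Rightarrow> real ^ 'n1 \<Rightarrow> real) \<Rightarrow> bool" where
  "quasi_supermodular Y1 F \<longleftrightarrow> (\<forall>y1 \<in> Y1. supermodular (\<lambda>x. F x y1))"

definition increment ::
  "(real ^ 'nx \<Rightarrow> real ^ 'n1 \<Rightarrow> real) \<Rightarrow> 'nx set \<Rightarrow> 'nx set \<Rightarrow> real ^ 'n1 \<Rightarrow> real" where
  "increment F S T y1 = F (indicator_vec (S \<union> T)) y1 - F (indicator_vec S) y1"

definition support :: "real ^ 'n \<Rightarrow> 'n set" where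
  "support z = {i. z $ i = 1}"

definition cut_rhs ::
  "real ^ 'n1 \<Rightarrow> (real ^ 'nx \<Rightarrow> real ^ 'n1 \<Rightarrow> real) \<Rightarrow> real ^ 'nx \<Rightarrow> real ^ 'n1 \<Rightarrow> real ^ 'nx \<Rightarrow> real" where
  "cut_rhs d1 F z y1 x =
     d1 \<bullet> y1 + F (indicator_vec (support z)) y1
     - (\<Sum>i \<in> support z. increment F (UNIV - {i}) {i} y1 * (1 - x $ i))
     + (\<Sum>i \<in> UNIV - support z. increment F (support z) {i} y1 * x $ i)"

end

theory Submission
  imports Defs
begin

text \<open>
  Identify binary vectors with subsets of the index set, and let \<open>g\<close> be the supermodular set function
  obtained from \<open>F\<close> by fixing the lower-level integer variable. Going from \<open>S\<close> up to \<open>S \<union> T\<close> one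
  element at a time gains at least the marginals at \<open>S\<close>, and going from \<open>T\<close> up to \<open>S \<union> T\<close> gains at most
  the marginals at the complements of singletons, since marginals of \<open>g\<close> increase with the set.
  Comparing the two bounds for \<open>g (S \<union> T)\<close> gives validity; the cut is tight at \<open>z\<close>, where both
  sums vanish.
\<close>

text \<open>Supermodularity for \<open>S \<union> {i}\<close> and \<open>S \<union> U\<close>, which
  meet in \<open>S\<close> when \<open>i\<close> is not in \<open>U\<close>, says that adding
  \<open>i\<close> to \<open>S \<union> U\<close> gains at least what adding it to \<open>S\<close>
  gains. Induction on \<open>U\<close> sums these gains.\<close>

lemma supermodular_set_sum_marginals_le:
  fixes g :: "'n set \<Rightarrow> real"
  assumes super: "\<And>A B. g A + g B \<le> g (A \<union> B) + g (A \<inter> B)"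
    and "finite U" "S \<inter> U = {}"
  shows "g S + (\<Sum>i\<in>U. g (S \<union> {i}) - g S) \<le> g (S \<union> U)"
  using assms(2,3)
proof (induction U rule: finite_induct)
  case empty
  then show ?case by simp
next
  case (insert i U)
  have "(S \<union> {i}) \<inter> (S \<union> U) = S" "(S \<union> {i}) \<union> (S \<union> U) = S \<union> insert i U"
    using insert by auto
  then have "g (S \<union> {i}) + g (S \<union> U) \<le> g (S \<union> insert i U) + g S"
    using super[of "S \<union> {i}" "S \<union> U"] by simp
  then show ?case using insert by simp
qed

text \<open>Dual argument: each gain is now compared with the largest possible one, the gain from
  \<open>UNIV - {i}\<close> to \<open>UNIV\<close>. The pair \<open>T \<union> insert i U\<close>
  and \<open>UNIV - {i}\<close> works because \<open>i\<close> lies in neither \<open>T\<close> nor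
  \<open>U\<close>.\<close>

lemma supermodular_set_le_sum_marginals:
  fixes g :: "'n set \<Rightarrow> real"
  assumes super: "\<And>A B. g A + g B \<le> g (A \<union> B) + g (A \<inter> B)"
    and "finite U" "T \<inter> U = {}"
  shows "g (T \<union> U) \<le> g T + (\<Sum>i\<in>U. g UNIV - g (UNIV - {i}))"
  using assms(2,3)
proof (induction U rule: finite_induct)
  case empty
  then show ?case by simp
next
  case (insert i U)
  have "(T \<union> insert i U) \<inter> (UNIV - {i}) = T \<union> U" "(T \<union> insert i U) \<union> (UNIV - {i}) = UNIV"
    using insert by auto
  then have "g (T \<union> insert i U) + g (UNIV - {i}) \<le> g UNIV + g (T \<union> U)"
    using super[of "T \<union> insert i U" "UNIV - {i}"] by simp
  then show ?case using insert by simp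
qed

lemma indicator_vec_in_binary_vectors: "indicator_vec S \<in> binary_vectors"
  by (simp add: binary_vectors_def indicator_vec_def indicator_def)

lemma indicator_vec_support:
  assumes "x \<in> binary_vectors"
  shows "indicator_vec (support x) = x"
  using assms by (auto simp: binary_vectors_def indicator_vec_def support_def vec_eq_iff indicator_def)

lemma supermodular_indicator_vec:
  assumes "supermodular f"
  shows "f (indicator_vec S) + f (indicator_vec T)
    \<le> f (indicator_vec (S \<union> T)) + f (indicator_vec (S \<inter> T))"
proof -
  have "sup (indicator_vec S) (indicator_vec T) = indicator_vec (S \<union> T)"
    "inf (indicator_vec S) (indicator_vec T) = indicator_vec (S \<inter> T)"
    by (auto simp: vec_eq_iff indicator_vec_def indicator_def sup_vec_def inf_vec_def sup_real_def inf_real_def)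
  then show ?thesis
    using assms indicator_vec_in_binary_vectors unfolding supermodular_def by metis
qed

text \<open>At a binary point the factors \<open>1 - x $ i\<close> and \<open>x $ i\<close> are 0 or
  1, so each sum keeps only the indices where \<open>x\<close> and \<open>z\<close> differ. The two
  index sets are the ones to which the marginal bounds apply.\<close>

lemma cut_rhs_eq:
  fixes x :: "real ^ 'nx"
  assumes x: "x \<in> binary_vectors"
  shows "cut_rhs d1 F z y1 x = d1 \<bullet> y1 + F (indicator_vec (support z)) y1
    - (\<Sum>i \<in> support z - support x. increment F (UNIV - {i}) {i} y1)
    + (\<Sum>i \<in> support x - support z. increment F (support z) {i} y1)"
proof -
  have x_i: "x $ i = (if i \<in> support x then 1 else 0)" for i
    using x by (auto simp: binary_vectors_def support_def)
  have "(\<Sum>i \<in> support z. increment F (UNIV - {i}) {i} y1 * (1 - x $ i))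
      = (\<Sum>i \<in> support z - support x. increment F (UNIV - {i}) {i} y1)"
    by (rule sum.mono_neutral_cong_right) (auto simp: x_i)
  moreover have "(\<Sum>i \<in> UNIV - support z. increment F (support z) {i} y1 * x $ i)
      = (\<Sum>i \<in> support x - support z. increment F (support z) {i} y1)"
    by (rule sum.mono_neutral_cong_right) (auto simp: x_i)
  ultimately show ?thesis by (simp add: cut_rhs_def)
qed

lemma cut_rhs_le:
  fixes x :: "real ^ 'nx"
  assumes super: "supermodular (\<lambda>x. F x y1)" and x: "x \<in> binary_vectors"
  shows "cut_rhs d1 F z y1 x \<le> d1 \<bullet> y1 + F x y1"
proof -
  define g where "g S = F (indicator_vec S) y1" for S :: "'nx set"
  define S where "S = support z"
  define T where "T = support x"
  have g: "g A + g B \<le> g (A \<union> B) + g (A \<inter> B)" for A B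
    unfolding g_def by (rule supermodular_indicator_vec[OF super])
  have "g S + (\<Sum>i\<in>T - S. g (S \<union> {i}) - g S) \<le> g (S \<union> T)"
    using supermodular_set_sum_marginals_le[OF g, of "T - S" S] by simp
  also have "g (S \<union> T) \<le> g T + (\<Sum>i\<in>S - T. g UNIV - g (UNIV - {i}))"
    using supermodular_set_le_sum_marginals[OF g, of "S - T" T] by (simp add: Un_commute)
  \<comment> \<open>Moving the sum over \<open>S - T\<close> to the left leaves \<open>g T\<close>,
    which is \<open>F x y1\<close> since \<open>x\<close> is the indicator vector of its
    support.\<close>
  finally show ?thesis
    using indicator_vec_support[OF x]
    by (simp add: cut_rhs_eq[OF x] increment_def g_def S_def T_def)
qed

lemma cut_rhs_self:
  assumes "z \<in> binary_vectors"
  shows "cut_rhs d1 F z y1 z = d1 \<bullet> y1 + F z y1"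
  using assms by (simp add: cut_rhs_eq indicator_vec_support)

lemma maximum_eqI:
  assumes "m \<in> V" "\<And>v. v \<in> V \<Longrightarrow> v \<le> m"
  shows "maximum V = m"
  unfolding maximum_def using assms by (intro Greatest_equality)

lemma le_maximum:
  assumes "has_maximum V" "v \<in> V"
  shows "v \<le> maximum V"
  using assms maximum_eqI unfolding has_maximum_def by metis

theorem proposition11:
  fixes d1 yhat :: "real ^ 'n1" and d2 :: "real ^ 'n2"
    and Y1 :: "(real ^ 'n1) set" and Y2 :: "(real ^ 'n2) set"
    and A :: "real ^ 'nx ^ 'm" and B1 :: "real ^ 'n1 ^ 'm" and B2 :: "real ^ 'n2 ^ 'm"
    and h :: "real ^ 'm"
    and F :: "real ^ 'nx \<Rightarrow> real ^ 'n1 \<Rightarrow> real"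
    and z :: "real ^ 'nx"
  assumes F_eq: "F = restricted_value d2 Y2 A B1 B2 h"
    and F_attained: "\<forall>x \<in> binary_vectors. \<forall>y1 \<in> Y1. has_maximum (restricted_values d2 Y2 A B1 B2 h x y1)"
    and lower_attained: "\<forall>x \<in> binary_vectors. has_maximum (lower_values d1 Y1 F x)"
    and quasi: "quasi_supermodular Y1 F"
    and z: "z \<in> binary_vectors"
    and yhat: "is_arg_max (\<lambda>y1. d1 \<bullet> y1 + F z y1) (\<lambda>y1. y1 \<in> Y1) yhat"
  shows "(\<forall>x \<in> binary_vectors. \<forall>y \<in> Y1 \<times> Y2.
            (d1, d2) \<bullet> y \<ge> lower_value d1 Y1 F x \<longrightarrow> (d1, d2) \<bullet> y \<ge> cut_rhs d1 F z yhat x)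
       \<and> (\<forall>x \<in> binary_vectors. cut_rhs d1 F z yhat x \<le> lower_value d1 Y1 F x)
       \<and> (\<exists>x \<in> binary_vectors. cut_rhs d1 F z yhat x = lower_value d1 Y1 F x)"
proof -
  have "yhat \<in> Y1" and yhat_max: "\<And>y1. y1 \<in> Y1 \<Longrightarrow> d1 \<bullet> y1 + F z y1 \<le> d1 \<bullet> yhat + F z yhat"
    using yhat by (auto simp: is_arg_max_linorder)
  have super: "supermodular (\<lambda>x. F x yhat)"
    using quasi \<open>yhat \<in> Y1\<close> by (simp add: quasi_supermodular_def)
  have valid: "cut_rhs d1 F z yhat x \<le> lower_value d1 Y1 F x" if x: "x \<in> binary_vectors" for x
  proof -
    have "cut_rhs d1 F z yhat x \<le> d1 \<bullet> yhat + F x yhat"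
      using super x by (rule cut_rhs_le)
    \<comment> \<open>\<open>Y1\<close> does not depend on \<open>x\<close>, so \<open>yhat\<close>,
      chosen for \<open>z\<close>, still competes in the maximum at \<open>x\<close>.\<close>
    also have "\<dots> \<le> lower_value d1 Y1 F x"
      unfolding lower_value_def using lower_attained x \<open>yhat \<in> Y1\<close>
      by (intro le_maximum) (auto simp: lower_values_def)
    finally show ?thesis .
  qed
  \<comment> \<open>The witness for tightness is \<open>z\<close>, where \<open>yhat\<close> attains
    the maximum.\<close>
  have "lower_value d1 Y1 F z = d1 \<bullet> yhat + F z yhat"
    unfolding lower_value_def using \<open>yhat \<in> Y1\<close> yhat_max
    by (intro maximum_eqI) (auto simp: lower_values_def)
  then have "cut_rhs d1 F z yhat z = lower_value d1 Y1 F z"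
    using cut_rhs_self[OF z] by simp
  then show ?thesis
    using valid z by (meson order_trans)
qed

end
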